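(* Let $g,n\ge0$ be integers with $2g-2+n>0$, let $(C,\vec p)$ be a stable $n$-marked curve of genus $g$, let $\vec r\in\mathbb{Z}_{\ge0}^n$ and let $L$ be a non-negative integer. Whenever $V_{C,\vec p}(\vec r,L)$ has dimension $>0$, there is a tree-like graph $\Gamma$ of genus $g$ with $n$ labeled leaves which is compatible with $\vec r$.
   Context: $V_{C,\vec p}(\vec r,L)$ is the space of $\mathfrak{sl}_2(\mathbb{C})$ conformal blocks of level $L$ on $(C,\vec p)$ with highest weight $r_i\in\mathbb{Z}_{\ge0}$ at the $i$-th marked point. Its dimension equals, for any trivalent graph $\Gamma$ of first Betti number $g$ with $n$ leaves labeled $1,\dots,n$, the number of non-negative integer weightings of the edges of $\Gamma$ such that at each trinode the three incident weights $w_1,w_2,w_3$ (a loop is listed twice) satisfy $|w_1-w_2|\le w_3\le w_1+w_2$, $w_1+w_2+w_3\le 2L$ and $w_1+w_2+w_3\in2\mathbb{Z}$, and such that the edge at the $i$-th leaf has weight $r_i$. A trivalent graph is a finite connected graph (loops and multiple edges allowed) whose vertices all have valence $3$ (trinodes; a loop contributes $2$) or $1$ (leaves). A trivalent graph of genus (first Betti number) $g$ with $n$ leaves is tree-like if it is obtained from a trivalent tree with $g+n$ leaves by adding loops on $g$ of the leaves. The vector $\vec r$ is compatible with $\Gamma$ if every odd $r_i$ is assigned to a leaf-edge which shares a vertex with the leaf-edge of another odd $r_j$. *)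

theory Defs
  imports Complex_Main "HOL-Library.FuncSet" "HOL-Library.Multiset"
    "Graph_Theory.Digraph_Component"
begin

text \<open>
  A finite undirected multigraph is represented by a \<^locale>\<open>fin_digraph\<close>: its arcs are the edges,
  each carrying an arbitrary orientation which none of the notions below depends on. In particular
  \<^const>\<open>Digraph_Component.connected\<close> is connectedness of the underlying undirected graph. A loop
  is both an in-arc and an out-arc of its vertex. The library constant \<^const>\<open>tree\<close> forbids only
  directed cycles, so it is not used.
\<close>

definition valence :: "('a, 'b) pre_digraph \<Rightarrow> 'a \<Rightarrow> nat" where
  "valence G v = in_degree G v + out_degree G v"

definition leaves :: "('a, 'b) pre_digraph \<Rightarrow> 'a set" where
  "leaves G = {v \<in> verts G. valence G v = 1}"

definition trinodes :: "('a, 'b) pre_digraph \<Rightarrow> 'a set" where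
  "trinodes G = {v \<in> verts G. valence G v = 3}"

definition trivalent_graph :: "('a, 'b) pre_digraph \<Rightarrow> bool" where
  "trivalent_graph G \<longleftrightarrow>
     fin_digraph G \<and> Digraph_Component.connected G \<and> verts G = leaves G \<union> trinodes G"

text \<open>The first Betti number of a finite \<^emph>\<open>connected\<close> graph.\<close>

definition first_betti_number :: "('a, 'b) pre_digraph \<Rightarrow> int" where
  "first_betti_number G = int (card (arcs G)) - int (card (verts G)) + 1"

definition trivalent_tree :: "('a, 'b) pre_digraph \<Rightarrow> bool" where
  "trivalent_tree T \<longleftrightarrow> trivalent_graph T \<and> first_betti_number T = 0"

definition leaf_labelling :: "('a, 'b) pre_digraph \<Rightarrow> nat \<Rightarrow> (nat \<Rightarrow> 'a) \<Rightarrow> bool" where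
  "leaf_labelling G n lf \<longleftrightarrow> bij_betw lf {1..n} (leaves G)"

text \<open>
  The arcs of \<open>G\<close> not in \<open>T\<close> are loops, exactly one at each vertex of a set \<open>S\<close> of \<open>g\<close> leaves of
  \<open>T\<close>. Since \<^const>\<open>spanning\<close> includes \<^const>\<open>compatible\<close>, the two graphs have the same vertices
  and the same end points of arcs.
\<close>

definition tree_like :: "('a, 'b) pre_digraph \<Rightarrow> nat \<Rightarrow> nat \<Rightarrow> bool" where
  "tree_like G g n \<longleftrightarrow>
     trivalent_graph G \<and> first_betti_number G = int g \<and> card (leaves G) = n \<and>
     (\<exists>T S. trivalent_tree T \<and> card (leaves T) = g + n \<and> spanning T G \<and>
        S \<subseteq> leaves T \<and> card S = g \<and>
        (\<forall>e \<in> arcs G - arcs T. tail G e = head G e) \<and>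
        bij_betw (tail G) (arcs G - arcs T) S)"

text \<open>The edges at \<open>v\<close>; for a leaf this is the singleton of its leaf-edge.\<close>

definition incident_edges :: "('a, 'b) pre_digraph \<Rightarrow> 'a \<Rightarrow> 'b set" where
  "incident_edges G v = in_arcs G v \<union> out_arcs G v"

text \<open>The weights at \<open>v\<close>, a loop at \<open>v\<close> being listed twice.\<close>

definition incident_weights ::
    "('a, 'b) pre_digraph \<Rightarrow> ('b \<Rightarrow> nat) \<Rightarrow> 'a \<Rightarrow> nat multiset" where
  "incident_weights G w v =
     image_mset w (mset_set (in_arcs G v)) + image_mset w (mset_set (out_arcs G v))"

text \<open>The condition is symmetric in the three weights, so the order in which they are listed is
  irrelevant.\<close>

definition admissible_trinode :: "nat \<Rightarrow> nat multiset \<Rightarrow> bool" where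
  "admissible_trinode L M \<longleftrightarrow>
     (\<exists>w1 w2 w3. M = {#w1, w2, w3#} \<and>
        \<bar>int w1 - int w2\<bar> \<le> int w3 \<and> w3 \<le> w1 + w2 \<and>
        w1 + w2 + w3 \<le> 2 * L \<and> even (w1 + w2 + w3))"

definition weightings ::
    "('a, 'b) pre_digraph \<Rightarrow> nat \<Rightarrow> (nat \<Rightarrow> 'a) \<Rightarrow> (nat \<Rightarrow> nat) \<Rightarrow> nat \<Rightarrow> ('b \<Rightarrow> nat) set" where
  "weightings G n lf r L =
     {w \<in> arcs G \<rightarrow>\<^sub>E UNIV.
        (\<forall>v \<in> trinodes G. admissible_trinode L (incident_weights G w v)) \<and>
        (\<forall>i \<in> {1..n}. \<forall>e \<in> incident_edges G (lf i). w e = r i)}"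

definition graph_compatible ::
    "('a, 'b) pre_digraph \<Rightarrow> nat \<Rightarrow> (nat \<Rightarrow> 'a) \<Rightarrow> (nat \<Rightarrow> nat) \<Rightarrow> bool" where
  "graph_compatible G n lf r \<longleftrightarrow>
     (\<forall>i \<in> {1..n}. odd (r i) \<longrightarrow>
        (\<exists>j \<in> {1..n}. j \<noteq> i \<and> odd (r j) \<and>
           (\<exists>e \<in> incident_edges G (lf i). \<exists>f \<in> incident_edges G (lf j).
              {tail G e, head G e} \<inter> {tail G f, head G f} \<noteq> {})))"

text \<open>
  The spaces of \<open>sl\<^sub>2\<close> conformal blocks enter through their dimension formula only.
  \<open>stable_curve g n C p\<close> stands for "\<open>(C, p 1, \<dots>, p n)\<close> is a stable \<open>n\<close>-marked curve of genus
  \<open>g\<close>", and \<open>V n C p r L\<close> for the space of conformal blocks of level \<open>L\<close> on that curve with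
  highest weight \<open>r i\<close> at \<open>p i\<close>, as a subspace of an ambient complex vector space. The values of
  \<open>p\<close> and \<open>r\<close> outside \<open>{1..n}\<close> are irrelevant; \<open>V\<close> takes \<open>n\<close> because the functions \<open>p\<close> and
  \<open>r\<close> do not determine it. Every finite graph is isomorphic to one of type
  \<open>(nat, nat) pre_digraph\<close>.
\<close>

locale sl2_conformal_blocks = vector_space scale
  for scale :: "complex \<Rightarrow> 'v::ab_group_add \<Rightarrow> 'v" +
  fixes stable_curve :: "nat \<Rightarrow> nat \<Rightarrow> 'c \<Rightarrow> (nat \<Rightarrow> 'p) \<Rightarrow> bool"
    and V :: "nat \<Rightarrow> 'c \<Rightarrow> (nat \<Rightarrow> 'p) \<Rightarrow> (nat \<Rightarrow> nat) \<Rightarrow> nat \<Rightarrow> 'v set"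
  assumes subspace_V: "stable_curve g n C p \<Longrightarrow> subspace (V n C p r L)"
    and dim_V: "\<lbrakk>2 * int g - 2 + int n > 0; stable_curve g n C p;
        trivalent_graph (\<Gamma> :: (nat, nat) pre_digraph); first_betti_number \<Gamma> = int g;
        leaf_labelling \<Gamma> n lf\<rbrakk>
      \<Longrightarrow> dim (V n C p r L) = card (weightings \<Gamma> n lf r L)"

end

theory Submission
  imports Defs
begin

text \<open>
  Compatibility hinges on the parity of the number of odd \<open>r i\<close>. A non-zero conformal block forces
  it to be even: summed over all vertices, the incident weights count every edge twice, and the
  trinodes contribute even numbers, so the leaves do as well (\<open>even_card_odd_leaf_weights\<close>). The
  dimension formula gives a weighting on any trivalent graph of genus \<open>g\<close> with \<open>n\<close> labelled leaves, in
  particular on a tree-like one that need not be compatible with \<open>r\<close>.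

  Conversely, let the number \<open>m\<close> of odd \<open>r i\<close> be even. It suffices to find a trivalent tree with
  \<open>g + n\<close> leaves in which \<open>m\<close> leaves come in pairs at common trinodes (\<open>tree_with_pairing\<close>): the
  loops go on \<open>g\<close> of the other leaves, and the odd labels on the paired ones. Such a tree grows
  from a tripod by attaching cherries, that is, two new edges at a leaf outside all pairs chosen so
  far. Each step adds one leaf, and the cherry may be kept as a pair or not: the number of unpaired
  leaves shrinks by one in the first case and grows by one in the second. Growing first and keeping
  the last cherries as pairs reaches every even \<open>m\<close> up to \<open>g + n\<close>. A tree with two leaves has no
  trinode, so only \<open>m = 0\<close> is possible for it; stability ensures this, since \<open>m = 2\<close> would mean
  \<open>g = 0\<close> and \<open>n = 2\<close>.
\<close>

section \<open>Parity of the odd leaf weights\<close>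

text \<open>Every edge has two ends, and a loop is listed twice at its vertex.\<close>

lemma handshake_weights:
  fixes w :: "'b \<Rightarrow> nat"
  assumes "fin_digraph G"
  shows "(\<Sum>v\<in>verts G. sum_mset (incident_weights G w v)) = 2 * (\<Sum>e\<in>arcs G. w e)"
proof -
  interpret fin_digraph G by fact
  have "(\<Sum>v\<in>verts G. \<Sum>e\<in>in_arcs G v. w e) = (\<Sum>e\<in>arcs G. w e)"
    unfolding in_arcs_def
    by (rule sum.group) (auto intro: head_in_verts)
  moreover have "(\<Sum>v\<in>verts G. \<Sum>e\<in>out_arcs G v. w e) = (\<Sum>e\<in>arcs G. w e)"
    unfolding out_arcs_def
    by (rule sum.group) (auto intro: tail_in_verts)
  moreover have "sum_mset (incident_weights G w v) =
      (\<Sum>e\<in>in_arcs G v. w e) + (\<Sum>e\<in>out_arcs G v. w e)" for v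
    by (simp add: incident_weights_def sum_unfold_sum_mset)
  ultimately show ?thesis
    by (simp add: sum.distrib)
qed

text \<open>
  In the handshake identity the total is even and so is the share of each trinode; what remains is
  the sum of the \<open>r i\<close>, because a leaf has exactly one incident weight.
\<close>

lemma even_card_odd_leaf_weights:
  assumes G: "trivalent_graph G" and lf: "leaf_labelling G n lf"
    and w: "w \<in> weightings G n lf r L"
  shows "even (card {i \<in> {1..n}. odd (r i)})"
proof -
  have fin: "fin_digraph G" and verts: "verts G = leaves G \<union> trinodes G"
    using G by (auto simp: trivalent_graph_def)
  interpret fin_digraph G by fact
  let ?s = "\<lambda>v. sum_mset (incident_weights G w v)"
  have finite: "finite (leaves G)" "finite (trinodes G)"
    by (auto simp: leaves_def trinodes_def)
  \<comment> \<open>All incident edges of a leaf carry \<open>r i\<close>, so the sum is the valence times \<open>r i\<close>; this avoids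
    naming the leaf-edge and its orientation.\<close>
  have leaf: "?s (lf i) = r i" if i: "i \<in> {1..n}" for i
  proof -
    have *: "w e = r i" if "e \<in> in_arcs G (lf i) \<or> e \<in> out_arcs G (lf i)" for e
      using w i that by (auto simp: weightings_def incident_edges_def)
    have "?s (lf i) = (\<Sum>e\<in>in_arcs G (lf i). w e) + (\<Sum>e\<in>out_arcs G (lf i). w e)"
      by (simp add: incident_weights_def sum_unfold_sum_mset)
    also have "\<dots> = valence G (lf i) * r i"
      using * by (simp add: valence_def in_degree_def out_degree_def algebra_simps)
    also have "valence G (lf i) = 1"
      using lf i by (auto simp: leaf_labelling_def leaves_def bij_betw_def)
    finally show ?thesis by simp
  qed
  have tri: "even (?s v)" if "v \<in> trinodes G" for v
    using w that by (auto simp: weightings_def admissible_trinode_def add.assoc)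
  have "2 * (\<Sum>e\<in>arcs G. w e) = (\<Sum>v\<in>leaves G. ?s v) + (\<Sum>v\<in>trinodes G. ?s v)"
    unfolding handshake_weights[OF fin, symmetric] verts
    by (rule sum.union_disjoint) (use finite in \<open>auto simp: leaves_def trinodes_def\<close>)
  moreover have "even (\<Sum>v\<in>trinodes G. ?s v)"
    using tri by (rule dvd_sum)
  ultimately have "even (\<Sum>v\<in>leaves G. ?s v)"
    by (metis dvd_triv_left even_add)
  also have "(\<Sum>v\<in>leaves G. ?s v) = (\<Sum>i\<in>{1..n}. ?s (lf i))"
    using lf unfolding leaf_labelling_def by (rule sum.reindex_bij_betw[symmetric])
  also have "\<dots> = (\<Sum>i\<in>{1..n}. r i)"
    using leaf by (rule sum.cong[OF refl])
  finally show ?thesis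
    by (simp add: even_sum_iff)
qed

section \<open>Rooted trees with loops\<close>

text \<open>
  A rooted tree on the vertices \<open>0, \<dots>, M\<close> is given by a parent below each vertex but the root \<open>0\<close>.
  Connectedness is then induction on the vertex, and the Betti number a plain count.
\<close>

definition parent_function :: "(nat \<Rightarrow> nat) \<Rightarrow> nat \<Rightarrow> bool" where
  "parent_function p M \<longleftrightarrow> (\<forall>e\<in>{1..M}. p e < e)"

text \<open>
  The arc from a vertex \<open>v > 0\<close> to its parent is named \<open>v\<close>, and the loop at \<open>v \<in> S\<close> is named
  \<open>M + 1 + v\<close>. The end points of all possible loops are fixed independently of \<open>S\<close>, because a
  spanning subgraph must have the very same \<^const>\<open>tail\<close> and \<^const>\<open>head\<close> functions.
\<close>

definition parent_graph :: "(nat \<Rightarrow> nat) \<Rightarrow> nat \<Rightarrow> nat set \<Rightarrow> (nat, nat) pre_digraph" where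
  "parent_graph p M S =
     \<lparr>verts = {..M}, arcs = {1..M} \<union> (\<lambda>v. M + 1 + v) ` S,
      tail = (\<lambda>e. if e \<le> M then e else e - (M + 1)),
      head = (\<lambda>e. if e \<le> M then p e else e - (M + 1))\<rparr>"

abbreviation parent_tree :: "(nat \<Rightarrow> nat) \<Rightarrow> nat \<Rightarrow> (nat, nat) pre_digraph" where
  "parent_tree p M \<equiv> parent_graph p M {}"

lemma parent_graph_simps [simp]:
  "verts (parent_graph p M S) = {..M}"
  "arcs (parent_graph p M S) = {1..M} \<union> (\<lambda>v. M + 1 + v) ` S"
  "tail (parent_graph p M S) = (\<lambda>e. if e \<le> M then e else e - (M + 1))"
  "head (parent_graph p M S) = (\<lambda>e. if e \<le> M then p e else e - (M + 1))"
  by (simp_all add: parent_graph_def)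

lemma fin_digraph_parent_graph:
  assumes p: "parent_function p M" and S: "S \<subseteq> {..M}"
  shows "fin_digraph (parent_graph p M S)"
proof
  fix e assume e: "e \<in> arcs (parent_graph p M S)"
  show "tail (parent_graph p M S) e \<in> verts (parent_graph p M S)"
    using e S by auto
  have "p e \<le> M" if "e \<in> {1..M}"
    using p that by (auto simp: parent_function_def dest!: bspec[of _ _ e])
  then show "head (parent_graph p M S) e \<in> verts (parent_graph p M S)"
    using e S by auto
qed (use S in \<open>auto intro: finite_subset\<close>)

text \<open>Following parents leads from every vertex down to the root.\<close>

lemma connected_parent_graph:
  assumes p: "parent_function p M" and S: "S \<subseteq> {..M}"
  shows "Digraph_Component.connected (parent_graph p M S)"
proof -
  let ?G = "parent_graph p M S" let ?H = "with_proj (mk_symmetric ?G)"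
  interpret G: fin_digraph ?G by (rule fin_digraph_parent_graph[OF assms])
  interpret H: pair_wf_digraph "mk_symmetric ?G" by (rule G.wellformed_mk_symmetric)
  have "v \<le> M \<Longrightarrow> v \<rightarrow>\<^sup>*\<^bsub>?H\<^esub> 0 \<and> 0 \<rightarrow>\<^sup>*\<^bsub>?H\<^esub> v" for v
  proof (induction v rule: less_induct)
    case (less v)
    show ?case
    proof (cases "v = 0")
      case True
      then show ?thesis using less.prems by (auto intro!: H.reachable_refl)
    next
      case False
      then have v: "v \<in> arcs ?G" "p v < v"
        using less.prems p by (auto simp: parent_function_def)
      then have "p v \<rightarrow>\<^sup>*\<^bsub>?H\<^esub> 0 \<and> 0 \<rightarrow>\<^sup>*\<^bsub>?H\<^esub> p v"
        using less by auto
      moreover have "(v, p v) \<in> parcs (mk_symmetric ?G)" "(p v, v) \<in> parcs (mk_symmetric ?G)"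
        unfolding parcs_mk_symmetric using v(1) less.prems by (auto intro!: bexI[of _ v])
      ultimately show ?thesis
        by (auto intro: H.adj_reachable_trans H.reachable_adj_trans)
    qed
  qed
  then show ?thesis
    unfolding connected_def
    by (intro strongly_connectedI) (auto intro: H.reachable_trans)
qed

lemma betti_parent_graph:
  assumes "finite S"
  shows "first_betti_number (parent_graph p M S) = int (card S)"
proof -
  have "card ({1..M} \<union> (\<lambda>v. M + 1 + v) ` S) = M + card ((\<lambda>v. M + 1 + v) ` S)"
    using assms by (subst card_Un_disjoint) auto
  also have "card ((\<lambda>v. M + 1 + v) ` S) = card S"
    by (rule card_image) (auto simp: inj_on_def)
  finally show ?thesis
    by (simp add: first_betti_number_def)
qed

text \<open>The three contributions are the children, the arc to the parent, and the loop.\<close>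

lemma valence_parent_graph:
  assumes S: "S \<subseteq> {..M}" and v: "v \<le> M"
  shows "valence (parent_graph p M S) v =
    card {e \<in> {1..M}. p e = v} + (if v = 0 then 0 else 1) + (if v \<in> S then 2 else 0)"
proof -
  have "in_arcs (parent_graph p M S) v =
      {e \<in> {1..M}. p e = v} \<union> (if v \<in> S then {M + 1 + v} else {})"
    using S by (auto simp: in_arcs_def image_iff)
  then have i: "in_degree (parent_graph p M S) v =
      card {e \<in> {1..M}. p e = v} + (if v \<in> S then 1 else 0)"
    unfolding in_degree_def by (auto simp: card_insert_if)
  have "out_arcs (parent_graph p M S) v =
      (if v = 0 then {} else {v}) \<union> (if v \<in> S then {M + 1 + v} else {})"
    using S v by (auto simp: out_arcs_def image_iff intro: gr0I)
  then have o: "out_degree (parent_graph p M S) v =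
      (if v = 0 then 0 else 1) + (if v \<in> S then 1 else 0)"
    unfolding out_degree_def using v by (auto simp: card_insert_if)
  show ?thesis
    unfolding valence_def i o by simp
qed

text \<open>A loop raises the valence of a leaf from 1 to 3 and changes no other vertex.\<close>

lemma tree_like_parent_graph:
  assumes p: "parent_function p M" and T: "trivalent_tree (parent_tree p M)"
    and S: "S \<subseteq> leaves (parent_tree p M)"
    and cards: "card (leaves (parent_tree p M)) = card S + n"
  shows "leaves (parent_graph p M S) = leaves (parent_tree p M) - S"
    and "tree_like (parent_graph p M S) (card S) n"
proof -
  let ?T = "parent_tree p M" let ?G = "parent_graph p M S"
  have SM: "S \<subseteq> {..M}"
    using S by (auto simp: leaves_def)
  then have finS: "finite S"
    by (rule finite_subset) simp
  have val: "valence ?G v = valence ?T v + (if v \<in> S then 2 else 0)" if "v \<le> M" for v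
    using that SM by (simp add: valence_parent_graph)
  have S1: "valence ?T v = 1" if "v \<in> S" for v
    using that S by (auto simp: leaves_def)
  show leaves: "leaves ?G = leaves ?T - S"
    using val S1 by (auto simp: leaves_def split: if_splits)
  have tri: "trinodes ?G = trinodes ?T \<union> S"
    using val S1 SM by (auto simp: trinodes_def split: if_splits)
  have "verts ?G = leaves ?G \<union> trinodes ?G"
    using T S unfolding leaves tri by (auto simp: trivalent_tree_def trivalent_graph_def)
  then have G: "trivalent_graph ?G"
    using fin_digraph_parent_graph[OF p SM] connected_parent_graph[OF p SM]
    by (simp add: trivalent_graph_def)
  have "finite (leaves ?T)"
    by (simp add: leaves_def)
  then have cardG: "card (leaves ?G) = n"
    unfolding leaves using S finS cards by (simp add: card_Diff_subset)
  have span: "spanning ?T ?G"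
    using fin_digraph_parent_graph[OF p SM] fin_digraph_parent_graph[OF p, of "{}"]
    by (auto simp: spanning_def subgraph_def compatible_def fin_digraph_def)
  have arcs: "arcs ?G - arcs ?T = (\<lambda>v. M + 1 + v) ` S"
    by auto
  have "bij_betw (tail ?G) (arcs ?G - arcs ?T) S"
    unfolding arcs by (intro bij_betw_byWitness[where f' = "\<lambda>v. M + 1 + v"]) auto
  moreover have "\<forall>e \<in> arcs ?G - arcs ?T. tail ?G e = head ?G e"
    unfolding arcs by auto
  ultimately show "tree_like ?G (card S) n"
    unfolding tree_like_def using G betti_parent_graph[OF finS] cardG T cards span S by blast
qed

section \<open>Growing trees by cherries\<close>

text \<open>The relation between leaves that \<^const>\<open>graph_compatible\<close> asks for.\<close>

definition leaf_edges_meet :: "('a, 'b) pre_digraph \<Rightarrow> 'a \<Rightarrow> 'a \<Rightarrow> bool" where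
  "leaf_edges_meet G x y \<longleftrightarrow>
     (\<exists>e \<in> incident_edges G x. \<exists>f \<in> incident_edges G y.
        {tail G e, head G e} \<inter> {tail G f, head G f} \<noteq> {})"

lemma leaf_edges_meet_sym: "leaf_edges_meet G x y \<Longrightarrow> leaf_edges_meet G y x"
  unfolding leaf_edges_meet_def by blast

text \<open>Hence leaves that are paired stay paired when cherries or loops are added elsewhere.\<close>

lemma leaf_edges_meet_mono:
  assumes "leaf_edges_meet G x y" and "arcs G \<subseteq> arcs H"
    and "\<And>e. e \<in> arcs G \<Longrightarrow> tail H e = tail G e" "\<And>e. e \<in> arcs G \<Longrightarrow> head H e = head G e"
  shows "leaf_edges_meet H x y"
proof -
  obtain e f where e: "e \<in> incident_edges G x" and f: "f \<in> incident_edges G y"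
    and ef: "{tail G e, head G e} \<inter> {tail G f, head G f} \<noteq> {}"
    using assms(1) unfolding leaf_edges_meet_def by blast
  have sub: "incident_edges G z \<subseteq> incident_edges H z" "incident_edges G z \<subseteq> arcs G" for z
    using assms(2-4) by (auto simp: incident_edges_def)
  have "{tail H e, head H e} \<inter> {tail H f, head H f} \<noteq> {}"
    using ef e f sub(2) assms(3,4) by (metis subsetD)
  then show ?thesis
    unfolding leaf_edges_meet_def using e f sub(1) by blast
qed

lemma trivalent_parent_tree_iff:
  assumes "parent_function p M"
  shows "trivalent_tree (parent_tree p M) \<longleftrightarrow>
    (\<forall>v\<le>M. valence (parent_tree p M) v \<in> {1, 3})"
  using fin_digraph_parent_graph[OF assms, of "{}"] connected_parent_graph[OF assms, of "{}"]
    betti_parent_graph[of "{}" p M]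
  by (auto simp: trivalent_tree_def trivalent_graph_def leaves_def trinodes_def)

text \<open>
  The growth step: the leaf \<open>v\<close> becomes the trinode that joins two new leaves, and all other
  valences and arcs are kept.
\<close>

lemma attach_cherry:
  assumes p: "parent_function p M" and T: "trivalent_tree (parent_tree p M)"
    and v: "v \<in> leaves (parent_tree p M)" "v \<noteq> 0"
  defines "q \<equiv> p(M + 1 := v, M + 2 := v)"
  shows "parent_function q (M + 2)"
    and "trivalent_tree (parent_tree q (M + 2))"
    and "leaves (parent_tree q (M + 2)) = leaves (parent_tree p M) - {v} \<union> {M + 1, M + 2}"
    and "leaf_edges_meet (parent_tree q (M + 2)) (M + 1) (M + 2)"
    and "leaf_edges_meet (parent_tree p M) x y \<Longrightarrow> leaf_edges_meet (parent_tree q (M + 2)) x y"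
proof -
  let ?T = "parent_tree p M" let ?U = "parent_tree q (M + 2)"
  have vM: "v \<le> M" and v1: "valence ?T v = 1"
    using v by (auto simp: leaves_def)
  have below: "p e < e" if "e \<in> {1..M}" for e
    using p that by (simp add: parent_function_def)
  show q: "parent_function q (M + 2)"
    using below vM by (auto simp: parent_function_def q_def)
  have children: "{e \<in> {1..M + 2}. q e = u} =
      {e \<in> {1..M}. p e = u} \<union> (if u = v then {M + 1, M + 2} else {})" for u
    by (auto simp: q_def)
  have old: "valence ?U u = valence ?T u + (if u = v then 2 else 0)" if "u \<le> M" for u
  proof -
    have "card {e \<in> {1..M + 2}. q e = u} =
        card {e \<in> {1..M}. p e = u} + card (if u = v then {M + 1, M + 2} else {})"
      unfolding children by (rule card_Un_disjoint) auto
    then show ?thesis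
      using that by (simp add: valence_parent_graph)
  qed
  have new: "valence ?U u = 1" if "u \<in> {M + 1, M + 2}" for u
  proof -
    have "{e \<in> {1..M + 2}. q e = u} = {}"
      unfolding children using that vM below by fastforce
    then show ?thesis
      using that by (subst valence_parent_graph) auto
  qed
  have T': "valence ?T u \<in> {1, 3}" if "u \<le> M" for u
    using T that unfolding trivalent_parent_tree_iff[OF p] by blast
  have split: "u \<le> M + 2 \<longleftrightarrow> u \<le> M \<or> u \<in> {M + 1, M + 2}" for u
    by auto
  show "trivalent_tree ?U"
    unfolding trivalent_parent_tree_iff[OF q] split
    using T' old new v1 by auto
  have "u \<in> leaves ?U \<longleftrightarrow> u \<in> leaves ?T - {v} \<union> {M + 1, M + 2}" for u
    unfolding leaves_def using new[of u] old[of u] v1 split[of u] by auto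
  then show "leaves ?U = leaves ?T - {v} \<union> {M + 1, M + 2}"
    by blast
  show "leaf_edges_meet ?U (M + 1) (M + 2)"
    unfolding leaf_edges_meet_def
    by (intro bexI[of _ "M + 1"] bexI[of _ "M + 2"])
       (auto simp: incident_edges_def out_arcs_def q_def)
  show "leaf_edges_meet ?T x y \<Longrightarrow> leaf_edges_meet ?U x y"
    by (erule leaf_edges_meet_mono) (auto simp: q_def)
qed

definition paired_leaves :: "('a, 'b) pre_digraph \<Rightarrow> 'a set \<Rightarrow> bool" where
  "paired_leaves G A \<longleftrightarrow> A \<subseteq> leaves G \<and> (\<forall>x\<in>A. \<exists>y\<in>A. y \<noteq> x \<and> leaf_edges_meet G x y)"

lemma single_edge_tree:
  "parent_function (\<lambda>_. 0) 1" "trivalent_tree (parent_tree (\<lambda>_. 0) 1)"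
  "leaves (parent_tree (\<lambda>_. 0) 1) = {0, 1}"
proof -
  show p: "parent_function (\<lambda>_. 0) 1"
    by (simp add: parent_function_def)
  have val: "valence (parent_tree (\<lambda>_. 0) 1) v = 1" if "v \<le> 1" for v
    using that by (auto simp: valence_parent_graph le_Suc_eq)
  show "trivalent_tree (parent_tree (\<lambda>_. 0) 1)"
    unfolding trivalent_parent_tree_iff[OF p] using val by blast
  show "leaves (parent_tree (\<lambda>_. 0) 1) = {0, 1}"
    using val by (auto simp: leaves_def)
qed

text \<open>
  The root is kept among the paired leaves, so that the leaves available for further cherries are
  never the root. The induction starts with the tripod, where the root and one of its grandchildren
  form a pair. For \<open>k = 1\<close> the new cherry is not counted as a pair, otherwise it is the \<open>k\<close>-th
  pair; either way the induction hypothesis leaves an unpaired leaf to attach it to.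
\<close>

lemma tree_with_rooted_pairing:
  assumes "3 \<le> N" and "1 \<le> k" and "2 * k \<le> N"
  shows "\<exists>p M A. parent_function p M \<and> trivalent_tree (parent_tree p M) \<and>
    card (leaves (parent_tree p M)) = N \<and> paired_leaves (parent_tree p M) A \<and>
    card A = 2 * k \<and> 0 \<in> A"
  using assms
proof (induction N arbitrary: k rule: dec_induct)
  case base
  then have k: "k = 1" by simp
  define q :: "nat \<Rightarrow> nat" where "q = (\<lambda>_. 0)(1 + 1 := 1, 1 + 2 := 1)"
  note cherry = attach_cherry[OF single_edge_tree(1,2), of 1, folded q_def,
      unfolded single_edge_tree(3), simplified]
  have leaves: "leaves (parent_tree q 3) = {0, 2, 3}"
    using cherry(3) by (auto simp: numeral_2_eq_2 numeral_3_eq_3)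
  have "leaf_edges_meet (parent_tree q 3) 0 2"
    unfolding leaf_edges_meet_def
    by (intro bexI[of _ 1] bexI[of _ 2])
       (auto simp: incident_edges_def out_arcs_def in_arcs_def q_def)
  then have "paired_leaves (parent_tree q 3) {0, 2}"
    unfolding paired_leaves_def leaves by (auto intro: leaf_edges_meet_sym)
  then show ?case
    using cherry(1,2) leaves k
    by (intro exI[of _ q] exI[of _ 3] exI[of _ "{0, 2}"]) (auto simp: numeral_3_eq_3)
next
  case (step N)
  \<comment> \<open>the number of pairs before the cherry is attached\<close>
  define j where "j = (if k = 1 then 1 else k - 1)"
  have j: "1 \<le> j" "2 * j < N"
    using step.hyps step.prems by (auto simp: j_def)
  obtain p M A where p: "parent_function p M" and T: "trivalent_tree (parent_tree p M)"
    and N: "card (leaves (parent_tree p M)) = N" and A: "paired_leaves (parent_tree p M) A"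
    and cA: "card A = 2 * j" and root: "0 \<in> A"
    using step.IH[of j] j by auto
  let ?T = "parent_tree p M"
  have fin: "finite (leaves ?T)"
    by (simp add: leaves_def)
  \<comment> \<open>\<open>A\<close> has only \<open>2 * j < N\<close> elements\<close>
  have "\<not> leaves ?T \<subseteq> A"
    using N cA j A fin card_mono[of A "leaves ?T"] finite_subset[of A "leaves ?T"]
    by (auto simp: paired_leaves_def)
  then obtain v where v: "v \<in> leaves ?T" "v \<notin> A" by blast
  then have v0: "v \<noteq> 0" using root by metis
  define q where "q = p(M + 1 := v, M + 2 := v)"
  let ?U = "parent_tree q (M + 2)"
  note cherry = attach_cherry[OF p T v(1) v0, folded q_def]
  have fresh: "M + 1 \<notin> leaves ?T" "M + 2 \<notin> leaves ?T"
    by (auto simp: leaves_def)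
  have "card (leaves ?T - {v}) = N - 1"
    using v(1) N by simp
  then have N': "card (leaves ?U) = Suc N"
    unfolding cherry(3) using fresh fin step.hyps by (simp add: card_insert_if)
  have A': "paired_leaves ?U A"
    using A v(2) cherry(5) unfolding paired_leaves_def cherry(3) by blast
  have AB: "paired_leaves ?U (A \<union> {M + 1, M + 2})"
    using A' cherry(4) leaf_edges_meet_sym[OF cherry(4)]
    unfolding paired_leaves_def cherry(3) by auto
  have "A \<inter> {M + 1, M + 2} = {}" "finite A"
    using A fresh fin by (auto simp: paired_leaves_def intro: finite_subset)
  then have cAB: "card (A \<union> {M + 1, M + 2}) = 2 * j + 2"
    using cA by (subst card_Un_disjoint) auto
  show ?case
  proof (cases "k = 1")
    case True
    then show ?thesis
      using cherry(1,2) N' A' cA root by (auto simp: j_def)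
  next
    case False
    then have "card (A \<union> {M + 1, M + 2}) = 2 * k"
      using cAB step.prems by (auto simp: j_def)
    then show ?thesis
      using cherry(1,2) N' AB root by blast
  qed
qed

text \<open>
  For \<open>m = 0\<close> the pairs just constructed are forgotten; the single edge supplies the tree with two
  leaves.
\<close>

lemma tree_with_pairing:
  assumes "2 \<le> N" and "even m" and "m \<le> N" and "N = 2 \<Longrightarrow> m = 0"
  shows "\<exists>p M A. parent_function p M \<and> trivalent_tree (parent_tree p M) \<and>
    card (leaves (parent_tree p M)) = N \<and> paired_leaves (parent_tree p M) A \<and> card A = m"
proof (cases "m = 0")
  case True
  have "\<exists>p M. parent_function p M \<and> trivalent_tree (parent_tree p M) \<and>
      card (leaves (parent_tree p M)) = N"
  proof (cases "N = 2")
    case True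
    then show ?thesis
      using single_edge_tree by (intro exI[of _ "\<lambda>_. 0"] exI[of _ 1]) simp
  next
    case False
    then show ?thesis
      using tree_with_rooted_pairing[of N 1] assms(1) by auto
  qed
  moreover have "paired_leaves G {}" for G :: "(nat, nat) pre_digraph"
    by (simp add: paired_leaves_def)
  ultimately show ?thesis
    using True by (metis card.empty)
next
  case False
  moreover have "N \<noteq> 2"
    using False assms(4) by blast
  ultimately have "3 \<le> N" "1 \<le> m div 2" "2 * (m div 2) \<le> N" "2 * (m div 2) = m"
    using assms(1-3) by (auto elim: evenE)
  then show ?thesis
    using tree_with_rooted_pairing[of N "m div 2"] by metis
qed

section \<open>Labelling the leaves\<close>

text \<open>
  The loops avoid the paired leaves \<open>A\<close>, which is possible because at most \<open>n\<close> of the \<open>g + n\<close> leaves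
  are in \<open>A\<close>. The labelling maps the odd indices onto \<open>A\<close>, so that the partner of an odd leaf is
  again odd; its other values are arbitrary.
\<close>

lemma tree_like_compatible_exists:
  assumes stable: "2 * int g - 2 + int n > 0" and even: "even (card {i \<in> {1..n}. odd (r i)})"
  shows "\<exists>(\<Gamma> :: (nat, nat) pre_digraph) lf.
           tree_like \<Gamma> g n \<and> leaf_labelling \<Gamma> n lf \<and> graph_compatible \<Gamma> n lf r"
proof -
  define Odd where "Odd = {i \<in> {1..n}. odd (r i)}"
  have Odd: "Odd \<subseteq> {1..n}" "finite Odd"
    by (auto simp: Odd_def)
  then have le: "card Odd \<le> n"
    using card_mono[of "{1..n}" Odd] by simp
  have "g + n = 2 \<Longrightarrow> card Odd = 0"
  proof (rule ccontr)
    assume "g + n = 2" "card Odd \<noteq> 0"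
    moreover have "card Odd \<noteq> 1"
      using even unfolding Odd_def[symmetric] by (metis odd_one)
    ultimately show False
      using le stable by linarith
  qed
  then obtain p M A where p: "parent_function p M" and T: "trivalent_tree (parent_tree p M)"
    and N: "card (leaves (parent_tree p M)) = g + n" and A: "paired_leaves (parent_tree p M) A"
    and cA: "card A = card Odd"
    using tree_with_pairing[of "g + n" "card Odd"] stable even le unfolding Odd_def by force
  let ?T = "parent_tree p M"
  have fin: "finite (leaves ?T)"
    by (simp add: leaves_def)
  have sub: "A \<subseteq> leaves ?T" and finA: "finite A"
    using A fin by (auto simp: paired_leaves_def intro: finite_subset)
  have "g \<le> card (leaves ?T - A)"
    using N cA le sub finA by (simp add: card_Diff_subset)
  then obtain S where S: "S \<subseteq> leaves ?T - A" "card S = g" "finite S"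
    by (rule obtain_subset_with_card_n)
  let ?G = "parent_graph p M S"
  have leaves: "leaves ?G = leaves ?T - S" and tl: "tree_like ?G g n"
    using tree_like_parent_graph[OF p T, of S n] S N by auto
  have cl: "card (leaves ?G) = n" "finite (leaves ?G)"
    using tl fin unfolding tree_like_def leaves by auto
  have AG: "A \<subseteq> leaves ?G"
    using sub S leaves by blast
  obtain f1 where f1: "bij_betw f1 Odd A"
    using finite_same_card_bij[OF Odd(2) finA] cA by auto
  have "card ({1..n} - Odd) = card (leaves ?G - A)"
    using Odd finA AG cl cA by (simp add: card_Diff_subset)
  then obtain f2 where f2: "bij_betw f2 ({1..n} - Odd) (leaves ?G - A)"
    using finite_same_card_bij cl(2) by blast
  define lf where "lf i = (if i \<in> Odd then f1 i else f2 i)" for i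
  have lfO: "bij_betw lf Odd A"
    using f1 by (rule bij_betw_cong[THEN iffD1, rotated]) (simp add: lf_def)
  have "bij_betw lf ({1..n} - Odd) (leaves ?G - A)"
    using f2 by (rule bij_betw_cong[THEN iffD1, rotated]) (simp add: lf_def)
  with lfO have "bij_betw lf (Odd \<union> ({1..n} - Odd)) (A \<union> (leaves ?G - A))"
    by (rule bij_betw_combine) auto
  then have lf: "leaf_labelling ?G n lf"
    using Odd(1) AG by (simp add: leaf_labelling_def Un_absorb1)
  have "\<exists>j\<in>{1..n}. j \<noteq> i \<and> odd (r j) \<and> leaf_edges_meet ?G (lf i) (lf j)"
    if "i \<in> {1..n}" "odd (r i)" for i
  proof -
    have "lf i \<in> A"
      using lfO that by (auto simp: bij_betw_def Odd_def)
    then obtain y where y: "y \<in> A" "y \<noteq> lf i" "leaf_edges_meet ?T (lf i) y"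
      using A unfolding paired_leaves_def by blast
    then obtain j where "j \<in> Odd" "lf j = y"
      using lfO by (auto simp: bij_betw_def)
    moreover have "leaf_edges_meet ?G (lf i) y"
      using y(3) by (rule leaf_edges_meet_mono) auto
    ultimately show ?thesis
      using y(2) by (auto simp: Odd_def)
  qed
  then have "graph_compatible ?G n lf r"
    by (auto simp: graph_compatible_def leaf_edges_meet_def)
  with tl lf show ?thesis by blast
qed

theorem proposition1p7:
  fixes g n L :: nat
    and r :: "nat \<Rightarrow> nat"
    and C :: 'c
    and p :: "nat \<Rightarrow> 'p"
    and scale :: "complex \<Rightarrow> 'v::ab_group_add \<Rightarrow> 'v"
    and stable_curve :: "nat \<Rightarrow> nat \<Rightarrow> 'c \<Rightarrow> (nat \<Rightarrow> 'p) \<Rightarrow> bool"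
    and V :: "nat \<Rightarrow> 'c \<Rightarrow> (nat \<Rightarrow> 'p) \<Rightarrow> (nat \<Rightarrow> nat) \<Rightarrow> nat \<Rightarrow> 'v set"
  assumes "sl2_conformal_blocks scale stable_curve V"
    and "2 * int g - 2 + int n > 0"
    and "stable_curve g n C p"
    and "vector_space.dim scale (V n C p r L) > 0"
  shows "\<exists>(\<Gamma> :: (nat, nat) pre_digraph) lf.
           tree_like \<Gamma> g n \<and> leaf_labelling \<Gamma> n lf \<and> graph_compatible \<Gamma> n lf r"
proof -
  interpret sl2_conformal_blocks scale stable_curve V by fact
  \<comment> \<open>With the constant \<open>0\<close> in place of \<open>r\<close> the parity condition holds trivially, which gives some labelled
    tree-like graph on which to evaluate the dimension formula.\<close>
  obtain \<Gamma> :: "(nat, nat) pre_digraph" and lf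
    where \<Gamma>: "tree_like \<Gamma> g n" and lf: "leaf_labelling \<Gamma> n lf"
    using tree_like_compatible_exists[OF assms(2), of "\<lambda>_. 0"] by auto
  have tri: "trivalent_graph \<Gamma>" and betti: "first_betti_number \<Gamma> = int g"
    using \<Gamma> by (auto simp: tree_like_def)
  have "card (weightings \<Gamma> n lf r L) > 0"
    using dim_V[OF assms(2,3) tri betti lf, of r L] assms(4) by simp
  then obtain w where "w \<in> weightings \<Gamma> n lf r L"
    by (auto simp: card_gt_0_iff)
  then have "even (card {i \<in> {1..n}. odd (r i)})"
    by (rule even_card_odd_leaf_weights[OF tri lf])
  then show ?thesis
    by (rule tree_like_compatible_exists[OF assms(2)])
qed

end
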